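(* The set $I^{\forall}_{TD^+} = \{e : (\forall L \in \mathcal L_e)[\mathrm{TD}^+(L,\mathcal L_e) < \infty]\}$ is $\Pi^0_4$-complete.
   Context: $W_0,W_1,\ldots$ is an acceptable numbering of all r.e. subsets of $\mathbb N$; $L^e_j = \{x : \langle j,x\rangle \in W_e\}$ and $\mathcal L_e = \{L^e_j : j\in\mathbb N\}$. For a family $\mathcal L$ of subsets of $\mathbb N$ and $L\in\mathcal L$, a positive teaching set for $L$ w.r.t. $\mathcal L$ is a set $S\subseteq L$ such that no $L'\in\mathcal L\setminus\{L\}$ satisfies $S\subseteq L'$. $\mathrm{TD}^+(L,\mathcal L)$ is the smallest size of a positive teaching set for $L$ w.r.t. $\mathcal L$, and is $\infty$ if there is no (finite) such set. $\Pi^0_n$-complete means definable by a $\Pi^0_n$ formula and every $\Pi^0_n$ set many-one reduces to it via a recursive function. *)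

theory Defs
  imports Main "HOL-Library.Nat_Bijection" "HOL-Library.Extended_Nat"
begin

text \<open>
  Programs carry no arity: a program denotes a partial function on argument lists of all
  lengths, and its restriction to lists of length k is a partial recursive function of k
  arguments (nowhere defined where a constructor does not fit the number of arguments).
\<close>

datatype program =
    Zero
  | Succ
  | Proj nat
  | Comp program "program list"
  | PrimRec program program
  | Mu program

primrec eval_prog :: "program \<Rightarrow> nat list \<Rightarrow> nat option" where
  "eval_prog Zero xs = Some 0"
| "eval_prog Succ xs = (case xs of [x] \<Rightarrow> Some (Suc x) | _ \<Rightarrow> None)"
| "eval_prog (Proj i) xs = (if i < length xs then Some (xs ! i) else None)"
| "eval_prog (Comp f gs) xs =
     (let vs = map (\<lambda>g. eval_prog g xs) gs
      in if None \<in> set vs then None else eval_prog f (map the vs))"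
| "eval_prog (PrimRec f g) xs =
     (case xs of
        [] \<Rightarrow> None
      | n # ys \<Rightarrow>
          rec_nat (eval_prog f ys)
            (\<lambda>m r. Option.bind r (\<lambda>v. eval_prog g (m # v # ys))) n)"
| "eval_prog (Mu f) xs =
     (if \<exists>n. eval_prog f (n # xs) = Some 0 \<and> (\<forall>m<n. \<exists>v. eval_prog f (m # xs) = Some (Suc v))
      then Some (LEAST n. eval_prog f (n # xs) = Some 0)
      else None)"

definition recursive_fun :: "(nat \<Rightarrow> nat) \<Rightarrow> bool" where
  "recursive_fun f \<longleftrightarrow> (\<exists>p. \<forall>x. eval_prog p [x] = Some (f x))"

definition recursive_rel :: "nat \<Rightarrow> (nat list \<Rightarrow> bool) \<Rightarrow> bool" where
  "recursive_rel k R \<longleftrightarrow>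
     (\<exists>p. \<forall>xs. length xs = k \<longrightarrow> eval_prog p xs = Some (if R xs then 1 else 0))"

definition re_set :: "nat set \<Rightarrow> bool" where
  "re_set A \<longleftrightarrow> A = {} \<or> (\<exists>f. recursive_fun f \<and> A = range f)"

text \<open>
  The r.e. analogue of Rogers' acceptable numberings: a uniformly r.e. numbering of all r.e.
  sets to which every uniformly r.e. numbering translates by a recursive function.
\<close>

definition uniformly_re :: "(nat \<Rightarrow> nat set) \<Rightarrow> bool" where
  "uniformly_re V \<longleftrightarrow> re_set {prod_encode (i, x) | i x. x \<in> V i}"

definition acceptable_numbering :: "(nat \<Rightarrow> nat set) \<Rightarrow> bool" where
  "acceptable_numbering W \<longleftrightarrow>
     range W = {A. re_set A} \<and>
     uniformly_re W \<and>
     (\<forall>V. uniformly_re V \<longrightarrow> (\<exists>f. recursive_fun f \<and> (\<forall>i. V i = W (f i))))"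

text \<open>
  Prefixes of n alternating number quantifiers in front of a matrix R; quantified variables
  are appended to the argument list in the order in which they are bound.
\<close>

fun pi_formula :: "nat \<Rightarrow> (nat list \<Rightarrow> bool) \<Rightarrow> nat list \<Rightarrow> bool"
  and sigma_formula :: "nat \<Rightarrow> (nat list \<Rightarrow> bool) \<Rightarrow> nat list \<Rightarrow> bool" where
  "pi_formula 0 R xs = R xs"
| "pi_formula (Suc n) R xs = (\<forall>y. sigma_formula n R (xs @ [y]))"
| "sigma_formula 0 R xs = R xs"
| "sigma_formula (Suc n) R xs = (\<exists>y. pi_formula n R (xs @ [y]))"

definition pi_set :: "nat \<Rightarrow> nat set \<Rightarrow> bool" where
  "pi_set n A \<longleftrightarrow> (\<exists>R. recursive_rel (Suc n) R \<and> A = {x. pi_formula n R [x]})"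

definition many_one_reducible :: "nat set \<Rightarrow> nat set \<Rightarrow> bool" where
  "many_one_reducible B A \<longleftrightarrow> (\<exists>f. recursive_fun f \<and> (\<forall>x. x \<in> B \<longleftrightarrow> f x \<in> A))"

definition pi_complete :: "nat \<Rightarrow> nat set \<Rightarrow> bool" where
  "pi_complete n A \<longleftrightarrow> pi_set n A \<and> (\<forall>B. pi_set n B \<longrightarrow> many_one_reducible B A)"

definition positive_teaching_set :: "nat set \<Rightarrow> nat set \<Rightarrow> nat set set \<Rightarrow> bool" where
  "positive_teaching_set S L F \<longleftrightarrow> S \<subseteq> L \<and> \<not> (\<exists>L' \<in> F - {L}. S \<subseteq> L')"

text \<open>The infimum of the empty set of extended naturals is \<open>\<infinity>\<close>.\<close>

definition TD_plus :: "nat set \<Rightarrow> nat set set \<Rightarrow> enat" where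
  "TD_plus L F = Inf {enat (card S) | S. finite S \<and> positive_teaching_set S L F}"

definition language :: "(nat \<Rightarrow> nat set) \<Rightarrow> nat \<Rightarrow> nat \<Rightarrow> nat set" where
  "language W e j = {x. prod_encode (j, x) \<in> W e}"

definition language_family :: "(nat \<Rightarrow> nat set) \<Rightarrow> nat \<Rightarrow> nat set set" where
  "language_family W e = {language W e j | j. True}"

definition I_forall_TD_plus :: "(nat \<Rightarrow> nat set) \<Rightarrow> nat set" where
  "I_forall_TD_plus W =
     {e. \<forall>L \<in> language_family W e. TD_plus L (language_family W e) < \<infinity>}"

end

theory Submission
  imports Defs
begin

text \<open>
  Upper bound: a language has a finite positive teaching set iff the part of it that is enumerated
  within some \<open>s\<close> steps is one, which avoids coding finite sets. So \<open>e\<close> is in the index set iff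
  for every \<open>j\<close> there is \<open>s\<close> such that every \<open>L\<^sub>k\<close> that contains stage \<open>s\<close> of \<open>L\<^sub>j\<close> (an r.e.
  condition) equals \<open>L\<^sub>j\<close> (a \<open>\<Pi>\<^sub>2\<close> condition).

  Hardness: for each \<open>a\<close>, the matrix \<open>\<exists>b. \<forall>c. \<exists>d. R x a b c d\<close> is turned into a subfamily
  consisting of a limit language \<open>M\<close> and approximations \<open>N\<^sub>b\<close>, each containing the part of \<open>M\<close> up
  to \<open>b\<close>. If \<open>b\<close> or a smaller number is a witness, then \<open>N\<^sub>b = M\<close>; otherwise \<open>N\<^sub>b\<close> is finite and
  taught by a marker of its own. Markers that are passed by the enumeration are put into \<open>M\<close>. Hence
  \<open>M\<close> is teachable iff all but finitely many \<open>N\<^sub>b\<close> equal \<open>M\<close>, that is, iff there is a witness.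
  Tagging by \<open>a\<close> makes the subfamilies independent.
\<close>

section \<open>Recursive functions and predicates\<close>

definition recursive_fun2 :: "(nat \<Rightarrow> nat \<Rightarrow> nat) \<Rightarrow> bool" where
  "recursive_fun2 h \<longleftrightarrow> (\<exists>p. \<forall>x y. eval_prog p [x, y] = Some (h x y))"

definition recursive_pred :: "(nat \<Rightarrow> bool) \<Rightarrow> bool" where
  "recursive_pred P \<longleftrightarrow> recursive_fun (\<lambda>x. if P x then 1 else 0)"

section \<open>Arithmetic by primitive recursion\<close>

lemma recursive_fun_id: "recursive_fun (\<lambda>x. x)"
  unfolding recursive_fun_def by (rule exI[of _ "Proj 0"]) simp

lemma recursive_fun_compose:
  assumes "recursive_fun f" "recursive_fun g"
  shows "recursive_fun (\<lambda>x. f (g x))"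
proof -
  obtain p q where "\<And>x. eval_prog p [x] = Some (f x)" "\<And>x. eval_prog q [x] = Some (g x)"
    using assms unfolding recursive_fun_def by auto
  then show ?thesis
    unfolding recursive_fun_def by (intro exI[of _ "Comp p [q]"]) simp
qed

lemma recursive_fun_compose2:
  assumes "recursive_fun2 h" "recursive_fun f" "recursive_fun g"
  shows "recursive_fun (\<lambda>x. h (f x) (g x))"
proof -
  obtain p q r where "\<And>x y. eval_prog p [x, y] = Some (h x y)"
    "\<And>x. eval_prog q [x] = Some (f x)" "\<And>x. eval_prog r [x] = Some (g x)"
    using assms unfolding recursive_fun_def recursive_fun2_def by auto
  then show ?thesis
    unfolding recursive_fun_def by (intro exI[of _ "Comp p [q, r]"]) simp
qed

lemma recursive_fun_Suc: "recursive_fun f \<Longrightarrow> recursive_fun (\<lambda>x. Suc (f x))"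
proof -
  have "recursive_fun Suc"
    unfolding recursive_fun_def by (rule exI[of _ Succ]) simp
  then show "recursive_fun f \<Longrightarrow> recursive_fun (\<lambda>x. Suc (f x))"
    by (rule recursive_fun_compose)
qed

lemma recursive_fun_const: "recursive_fun (\<lambda>_. c)"
proof (induction c)
  case 0
  show ?case unfolding recursive_fun_def by (rule exI[of _ Zero]) simp
qed (rule recursive_fun_Suc)

text \<open>The step \<open>h\<close> has three arguments, so it is asked for as a program. The
  order \<open>m\<close>, \<open>v\<close>, \<open>x\<close> is that in which \<open>PrimRec\<close>
  calls its second program: index, previous value, parameter.\<close>

lemma recursive_fun2_primrec:
  assumes "recursive_fun a" "\<And>n x. r n x = rec_nat (a x) (\<lambda>m v. h m v x) n"
    and "\<exists>p. \<forall>m v x. eval_prog p [m, v, x] = Some (h m v x)"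
  shows "recursive_fun2 r"
proof -
  obtain p q where p: "\<And>x. eval_prog p [x] = Some (a x)"
    and q: "\<And>m v x. eval_prog q [m, v, x] = Some (h m v x)"
    using assms(1,3) unfolding recursive_fun_def by auto
  have "eval_prog (PrimRec p q) [n, x] = Some (r n x)" for n x
    unfolding assms(2) by (induction n) (simp_all add: p q)
  then show ?thesis unfolding recursive_fun2_def by blast
qed

lemma recursive_fun2_add: "recursive_fun2 (+)"
proof (rule recursive_fun2_primrec[OF recursive_fun_id])
  show "n + x = rec_nat x (\<lambda>m v. Suc v) n" for n x by (induction n) auto
  show "\<exists>p. \<forall>m v x. eval_prog p [m, v, x] = Some (Suc v)"
    by (rule exI[of _ "Comp Succ [Proj 1]"]) simp
qed

lemmas recursive_fun_add = recursive_fun_compose2[OF recursive_fun2_add]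

lemma recursive_fun_times:
  assumes "recursive_fun f" "recursive_fun g"
  shows "recursive_fun (\<lambda>x. f x * g x)"
proof -
  obtain p where p: "\<And>x y. eval_prog p [x, y] = Some (x + y)"
    using recursive_fun2_add unfolding recursive_fun2_def by auto
  have "recursive_fun2 (*)"
  proof (rule recursive_fun2_primrec[OF recursive_fun_const])
    show "n * x = rec_nat 0 (\<lambda>m v. v + x) n" for n x by (induction n) auto
    show "\<exists>p. \<forall>m v x. eval_prog p [m, v, x] = Some (v + x)"
      by (rule exI[of _ "Comp p [Proj 1, Proj 2]"]) (simp add: p)
  qed
  from recursive_fun_compose2[OF this assms] show ?thesis .
qed

lemma recursive_fun_diff:
  assumes "recursive_fun f" "recursive_fun g"
  shows "recursive_fun (\<lambda>x. f x - g x)"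
proof -
  \<comment> \<open>Primitive recursion that returns its own index is the predecessor, with value 0
    at 0.\<close>
  define p where "p = PrimRec Zero (Proj 0)"
  have p: "eval_prog p [x] = Some (x - 1)" for x
    by (induction x) (simp_all add: p_def)
  \<comment> \<open>The predecessor is iterated with the subtrahend as recursion variable, hence the
    reversed arguments.\<close>
  have "recursive_fun2 (\<lambda>n x. x - n)"
  proof (rule recursive_fun2_primrec[OF recursive_fun_id])
    show "x - n = rec_nat x (\<lambda>m v. v - 1) n" for n x :: nat by (induction n) auto
    show "\<exists>p. \<forall>m v x. eval_prog p [m, v, x] = Some (v - 1)"
      by (rule exI[of _ "Comp p [Proj 1]"]) (simp add: p)
  qed
  from recursive_fun_compose2[OF this assms(2,1)] show ?thesis .
qed

lemma recursive_fun_primrec1: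
  assumes "recursive_fun2 h" "\<And>n. r (Suc n) = h n (r n)"
  shows "recursive_fun r"
proof -
  obtain q where q: "\<And>x y. eval_prog q [x, y] = Some (h x y)"
    using assms(1) unfolding recursive_fun2_def by auto
  obtain p where p: "\<And>x. eval_prog p [x] = Some (r 0)"
    using recursive_fun_const[of "r 0"] unfolding recursive_fun_def by auto
  \<comment> \<open>Without parameters the base program runs on the empty list; \<open>Zero\<close>
    is defined there and supplies \<open>p\<close> with an argument.\<close>
  have "eval_prog (PrimRec (Comp p [Zero]) q) [n] = Some (r n)" for n
    by (induction n) (simp_all add: p q assms(2))
  then show ?thesis unfolding recursive_fun_def by blast
qed

lemma recursive_fun_triangle:
  assumes "recursive_fun f"
  shows "recursive_fun (\<lambda>x. triangle (f x))"
proof -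
  obtain p where p: "\<And>x y. eval_prog p [x, y] = Some (x + y)"
    using recursive_fun2_add unfolding recursive_fun2_def by auto
  have "recursive_fun triangle"
  proof (rule recursive_fun_primrec1)
    show "recursive_fun2 (\<lambda>n v. v + Suc n)"
      unfolding recursive_fun2_def
      by (rule exI[of _ "Comp p [Proj 1, Comp Succ [Proj 0]]"]) (simp add: p)
    show "triangle (Suc n) = triangle n + Suc n" for n by simp
  qed
  from recursive_fun_compose[OF this assms] show ?thesis .
qed

section \<open>The pairing function and its inverse\<close>

lemma recursive_fun2_prod_encode: "recursive_fun2 (\<lambda>x y. prod_encode (x, y))"
proof -
  obtain p q where p: "\<And>x y. eval_prog p [x, y] = Some (x + y)"
    and q: "\<And>x. eval_prog q [x] = Some (triangle x)"
    using recursive_fun2_add recursive_fun_triangle[OF recursive_fun_id]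
    unfolding recursive_fun2_def recursive_fun_def by auto
  show ?thesis
    unfolding recursive_fun2_def
    by (rule exI[of _ "Comp p [Comp q [p], Proj 0]"]) (simp add: p q prod_encode_def)
qed

lemmas recursive_fun_prod_encode = recursive_fun_compose2[OF recursive_fun2_prod_encode]

text \<open>The index of the diagonal of the pairing function on which a number lies.\<close>

primrec diagonal :: "nat \<Rightarrow> nat" where
  "diagonal 0 = 0"
| "diagonal (Suc z) = diagonal z + (1 - (triangle (Suc (diagonal z)) - Suc z))"

text \<open>The increment in the recursion is 1 exactly when \<open>Suc z\<close> has reached the
  next triangular number, which it cannot overshoot.\<close>

lemma diagonal_bounds: "triangle (diagonal z) \<le> z \<and> z < triangle (Suc (diagonal z))"
proof (induction z)
  case (Suc z)
  show ?case
  proof (cases "triangle (Suc (diagonal z)) \<le> Suc z")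
    case True
    then have "Suc z = triangle (Suc (diagonal z))" using Suc by linarith
    then show ?thesis by simp
  next
    case False
    then show ?thesis using Suc by simp
  qed
qed simp

text \<open>On diagonal \<open>d\<close> the first component is the offset from
  \<open>triangle d\<close>, and both components add up to \<open>d\<close>. This reduces decoding
  to truncated subtraction.\<close>

lemma prod_decode_diagonal:
  "prod_decode z = (z - triangle (diagonal z), diagonal z - (z - triangle (diagonal z)))"
proof -
  have "z = prod_encode (z - triangle (diagonal z), diagonal z - (z - triangle (diagonal z)))"
    using diagonal_bounds[of z] by (simp add: prod_encode_def)
  then show ?thesis by (metis prod_encode_inverse)
qed

lemma eq_prod_encode_iff:
  "z = prod_encode (a, b) \<longleftrightarrow> fst (prod_decode z) = a \<and> snd (prod_decode z) = b"
proof -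
  have "z = prod_encode (a, b) \<longleftrightarrow> prod_decode z = (a, b)"
    by (metis prod_decode_inverse prod_encode_inverse)
  then show ?thesis by (simp add: prod_eq_iff)
qed

lemma recursive_fun_diagonal:
  assumes "recursive_fun f"
  shows "recursive_fun (\<lambda>x. diagonal (f x))"
proof -
  have "recursive_fun2 (\<lambda>z v. v + (1 - (triangle (Suc v) - Suc z)))"
  proof -
    obtain d where d: "\<And>x. eval_prog d [x] = Some (triangle (Suc x))"
      using recursive_fun_triangle[OF recursive_fun_Suc[OF recursive_fun_id]]
      unfolding recursive_fun_def by auto
    obtain p where p: "\<And>x y. eval_prog p [x, y] = Some (x + y)"
      using recursive_fun2_add unfolding recursive_fun2_def by auto
    define c where "c = PrimRec Zero (Proj 0)"
    have c: "eval_prog c [x] = Some (x - 1)" for x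
      by (induction x) (simp_all add: c_def)
    define s where "s = PrimRec (Proj 0) (Comp c [Proj 1])"
    have s: "eval_prog s [n, x] = Some (x - n)" for n x
      by (induction n) (simp_all add: s_def c)
    show ?thesis unfolding recursive_fun2_def
      by (rule exI[of _ "Comp p [Proj 1, Comp s [Comp s [Comp Succ [Proj 0], Comp d [Proj 1]],
        Comp Succ [Zero]]]"])
        (simp add: p s d)
  qed
  then have "recursive_fun diagonal" by (rule recursive_fun_primrec1) simp
  from recursive_fun_compose[OF this assms] show ?thesis .
qed

lemma recursive_fun_fst:
  "recursive_fun f \<Longrightarrow> recursive_fun (\<lambda>x. fst (prod_decode (f x)))"
  unfolding prod_decode_diagonal fst_conv
  by (intro recursive_fun_diff recursive_fun_triangle recursive_fun_diagonal)

lemma recursive_fun_snd: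
  "recursive_fun f \<Longrightarrow> recursive_fun (\<lambda>x. snd (prod_decode (f x)))"
  unfolding prod_decode_diagonal snd_conv
  by (intro recursive_fun_diff recursive_fun_triangle recursive_fun_diagonal)

section \<open>Closure properties of recursive predicates\<close>

lemma recursive_pred_comp:
  "recursive_pred P \<Longrightarrow> recursive_fun f \<Longrightarrow> recursive_pred (\<lambda>x. P (f x))"
  unfolding recursive_pred_def by (rule recursive_fun_compose)

lemma recursive_pred_comp2:
  assumes "recursive_pred (\<lambda>z. P (fst (prod_decode z)) (snd (prod_decode z)))"
    and "recursive_fun f" "recursive_fun g"
  shows "recursive_pred (\<lambda>x. P (f x) (g x))"
  using recursive_pred_comp[OF assms(1) recursive_fun_prod_encode[OF assms(2,3)]] by simp

lemma recursive_pred_not: "recursive_pred P \<Longrightarrow> recursive_pred (\<lambda>x. \<not> P x)"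
proof -
  assume "recursive_pred P"
  then have "recursive_fun (\<lambda>x. 1 - (if P x then 1 else 0))"
    unfolding recursive_pred_def by (intro recursive_fun_diff recursive_fun_const)
  moreover have "(\<lambda>x. 1 - (if P x then 1 else 0 :: nat)) = (\<lambda>x. if \<not> P x then 1 else 0)"
    by auto
  ultimately show ?thesis unfolding recursive_pred_def by simp
qed

lemma recursive_pred_conj:
  "recursive_pred P \<Longrightarrow> recursive_pred Q \<Longrightarrow> recursive_pred (\<lambda>x. P x \<and> Q x)"
proof -
  assume "recursive_pred P" "recursive_pred Q"
  then have "recursive_fun (\<lambda>x. (if P x then 1 else 0) * (if Q x then 1 else 0))"
    unfolding recursive_pred_def by (rule recursive_fun_times)
  moreover have "(\<lambda>x. (if P x then 1 else 0) * (if Q x then 1 else 0 :: nat)) =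
      (\<lambda>x. if P x \<and> Q x then 1 else 0)"
    by auto
  ultimately show ?thesis unfolding recursive_pred_def by simp
qed

lemma recursive_pred_disj:
  assumes "recursive_pred P" "recursive_pred Q"
  shows "recursive_pred (\<lambda>x. P x \<or> Q x)"
  using recursive_pred_not[OF recursive_pred_conj[OF assms[THEN recursive_pred_not]]] by simp

lemma recursive_pred_le:
  assumes "recursive_fun f" "recursive_fun g"
  shows "recursive_pred (\<lambda>x. f x \<le> g x)"
proof -
  have "recursive_fun (\<lambda>x. 1 - (f x - g x))"
    by (intro recursive_fun_diff recursive_fun_const assms)
  moreover have "(\<lambda>x. 1 - (f x - g x)) = (\<lambda>x. if f x \<le> g x then 1 else 0)"
    by auto
  ultimately show ?thesis unfolding recursive_pred_def by simp
qed

lemma recursive_pred_eq: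
  assumes "recursive_fun f" "recursive_fun g"
  shows "recursive_pred (\<lambda>x. f x = g x)"
  using recursive_pred_conj[OF recursive_pred_le[OF assms] recursive_pred_le[OF assms(2,1)]]
  by (simp add: order_eq_iff)

lemma recursive_fun_if:
  assumes "recursive_pred P" "recursive_fun f" "recursive_fun g"
  shows "recursive_fun (\<lambda>x. if P x then f x else g x)"
proof -
  have "recursive_fun (\<lambda>x. (if P x then 1 else 0) * f x + (if \<not> P x then 1 else 0) * g x)"
    using assms(1) recursive_pred_not[OF assms(1)] assms(2,3) unfolding recursive_pred_def
    by (intro recursive_fun_add recursive_fun_times)
  moreover have "(\<lambda>x. (if P x then 1 else 0) * f x + (if \<not> P x then 1 else 0) * g x) =
      (\<lambda>x. if P x then f x else g x)"
    by auto
  ultimately show ?thesis by simp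
qed

text \<open>
  A predicate in the scope of a quantifier is viewed as a predicate of one number, which codes
  the pair of the outer context and the bound variable.
\<close>

lemma recursive_pred_ball:
  assumes "recursive_pred (\<lambda>z. P (fst (prod_decode z)) (snd (prod_decode z)))"
    and b: "recursive_fun b"
  shows "recursive_pred (\<lambda>x. \<forall>n<b x. P x n)"
proof -
  \<comment> \<open>Starting from 1, the value drops to 0 at the first \<open>m\<close> violating
    \<open>P\<close> and then stays 0.\<close>
  let ?h = "\<lambda>m v x. if P x m then v else 0 :: nat"
  have 1: "recursive_pred (\<lambda>z. P (snd (prod_decode z))
      (fst (prod_decode (fst (prod_decode z)))))"
    using recursive_pred_comp[OF assms(1), of "\<lambda>z. prod_encode (snd (prod_decode z),
      fst (prod_decode (fst (prod_decode z))))"]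
    by (simp add: recursive_fun_prod_encode recursive_fun_fst recursive_fun_snd recursive_fun_id)
  \<comment> \<open>The three arguments are packed as \<open>((m, v), x)\<close>, so that the
    closure rules for unary functions yield the program.\<close>
  have "recursive_fun (\<lambda>z. ?h (fst (prod_decode (fst (prod_decode z))))
      (snd (prod_decode (fst (prod_decode z)))) (snd (prod_decode z)))"
    by (intro recursive_fun_if 1 recursive_fun_fst recursive_fun_snd recursive_fun_id
        recursive_fun_const)
  then obtain p where p: "\<And>z. eval_prog p [z] = Some (?h (fst (prod_decode (fst (prod_decode z))))
      (snd (prod_decode (fst (prod_decode z)))) (snd (prod_decode z)))"
    unfolding recursive_fun_def by blast
  obtain q where q: "\<And>x y. eval_prog q [x, y] = Some (prod_encode (x, y))"
    using recursive_fun2_prod_encode unfolding recursive_fun2_def by auto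
  have "recursive_fun2 (\<lambda>n x. rec_nat 1 (\<lambda>m v. ?h m v x) n)"
  proof (rule recursive_fun2_primrec[OF recursive_fun_const refl])
    show "\<exists>p. \<forall>m v x. eval_prog p [m, v, x] = Some (?h m v x)"
      by (rule exI[of _ "Comp p [Comp q [Comp q [Proj 0, Proj 1], Proj 2]]"]) (simp add: p q)
  qed
  moreover have "rec_nat 1 (\<lambda>m v. ?h m v x) n = (if \<forall>m<n. P x m then 1 else 0)" for n x
    by (induction n) (auto simp: less_Suc_eq)
  ultimately have "recursive_fun2 (\<lambda>n x. if \<forall>m<n. P x m then 1 else 0)" by simp
  from recursive_fun_compose2[OF this b recursive_fun_id] show ?thesis
    unfolding recursive_pred_def .
qed

lemma recursive_pred_bex:
  assumes "recursive_pred (\<lambda>z. P (fst (prod_decode z)) (snd (prod_decode z)))"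
    and "recursive_fun b"
  shows "recursive_pred (\<lambda>x. \<exists>n<b x. P x n)"
  using recursive_pred_not[OF recursive_pred_ball[of "\<lambda>x n. \<not> P x n",
        OF recursive_pred_not[OF assms(1)] assms(2)]] by simp

text \<open>Brings the matrix of an arithmetical formula, a relation on lists, into the unary
  setting by composing programs.\<close>

lemma recursive_rel_imp_recursive_pred:
  assumes "recursive_rel (length fs) R" "\<And>f. f \<in> set fs \<Longrightarrow> recursive_fun f"
  shows "recursive_pred (\<lambda>x. R (map (\<lambda>f. f x) fs))"
proof -
  obtain p where p: "\<And>xs. length xs = length fs \<Longrightarrow>
      eval_prog p xs = Some (if R xs then 1 else 0)"
    using assms(1) unfolding recursive_rel_def by blast
  have "\<forall>f\<in>set fs. \<exists>q. \<forall>x. eval_prog q [x] = Some (f x)"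
    using assms(2) unfolding recursive_fun_def by blast
  then obtain q where q: "\<And>f x. f \<in> set fs \<Longrightarrow> eval_prog (q f) [x] = Some (f x)"
    by metis
  have "eval_prog (Comp p (map q fs)) [x] = Some (if R (map (\<lambda>f. f x) fs) then 1 else 0)" for x
  proof -
    have "map (\<lambda>g. eval_prog g [x]) (map q fs) = map (\<lambda>f. Some (f x)) fs"
      using q by simp
    then have "eval_prog (Comp p (map q fs)) [x] =
        (let vs = map (\<lambda>f. Some (f x)) fs in
         if None \<in> set vs then None else eval_prog p (map the vs))"
      by (simp only: eval_prog.simps)
    also have "\<dots> = eval_prog p (map (\<lambda>f. f x) fs)" by (auto simp: comp_def)
    finally show ?thesis by (simp add: p)
  qed
  then show ?thesis unfolding recursive_pred_def recursive_fun_def by blast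
qed

lemmas recursive_intros =
  recursive_fun_id recursive_fun_const recursive_fun_Suc recursive_fun_diff
  recursive_fun_prod_encode recursive_fun_fst recursive_fun_snd
  recursive_pred_not recursive_pred_conj recursive_pred_disj
  recursive_pred_le recursive_pred_eq recursive_pred_ball recursive_pred_bex

section \<open>Semidecidable and \<open>\<Pi>\<^sub>2\<close> predicates\<close>

text \<open>The r.e. predicates as projections of decidable ones; the witness \<open>t\<close>
  replaces a halting time.\<close>

definition semidecidable :: "(nat \<Rightarrow> bool) \<Rightarrow> bool" where
  "semidecidable P \<longleftrightarrow>
     (\<exists>Q. recursive_pred Q \<and> (\<forall>x. P x \<longleftrightarrow> (\<exists>t. Q (prod_encode (x, t)))))"

definition pi2_pred :: "(nat \<Rightarrow> bool) \<Rightarrow> bool" where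
  "pi2_pred P \<longleftrightarrow> (\<exists>Q. semidecidable Q \<and> (\<forall>x. P x \<longleftrightarrow> (\<forall>t. Q (prod_encode (x, t)))))"

lemma semidecidableI:
  assumes "recursive_pred (\<lambda>z. Q (fst (prod_decode z)) (snd (prod_decode z)))"
    and "\<And>x. P x \<longleftrightarrow> (\<exists>t. Q x t)"
  shows "semidecidable P"
  unfolding semidecidable_def using assms by (intro exI conjI) auto

lemma semidecidableD:
  assumes "semidecidable P"
  shows "\<exists>Q. recursive_pred (\<lambda>z. Q (fst (prod_decode z)) (snd (prod_decode z))) \<and>
    (\<forall>x. P x \<longleftrightarrow> (\<exists>t. Q x t))"
proof -
  obtain Q where "recursive_pred Q" and "\<And>x. P x \<longleftrightarrow> (\<exists>t. Q (prod_encode (x, t)))"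
    using assms unfolding semidecidable_def by blast
  then show ?thesis
    by (intro exI[of _ "\<lambda>x t. Q (prod_encode (x, t))"]) simp
qed

lemma pi2_predI:
  assumes "semidecidable (\<lambda>z. Q (fst (prod_decode z)) (snd (prod_decode z)))"
    and "\<And>x. P x \<longleftrightarrow> (\<forall>t. Q x t)"
  shows "pi2_pred P"
  unfolding pi2_pred_def using assms by (intro exI conjI) auto

lemma semidecidable_comp:
  assumes "semidecidable P" "recursive_fun f"
  shows "semidecidable (\<lambda>x. P (f x))"
proof -
  obtain Q where Q: "recursive_pred (\<lambda>z. Q (fst (prod_decode z)) (snd (prod_decode z)))"
    "\<And>x. P x \<longleftrightarrow> (\<exists>t. Q x t)"
    using semidecidableD[OF assms(1)] by blast
  show ?thesis
    by (rule semidecidableI[where Q = "\<lambda>x t. Q (f x) t"])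
      (intro recursive_pred_comp2[OF Q(1)] recursive_intros recursive_fun_compose[OF assms(2)],
        rule Q)
qed

lemma semidecidable_recursive: "recursive_pred P \<Longrightarrow> semidecidable P"
  by (rule semidecidableI[where Q = "\<lambda>x t. P x"])
    (rule recursive_pred_comp, assumption, intro recursive_intros, simp)

text \<open>Two existential quantifiers contract to one over codes of pairs.\<close>

lemma semidecidable_ex:
  assumes "semidecidable (\<lambda>z. P (fst (prod_decode z)) (snd (prod_decode z)))"
  shows "semidecidable (\<lambda>x. \<exists>n. P x n)"
proof -
  obtain Q where Q: "recursive_pred (\<lambda>z. Q (fst (prod_decode z)) (snd (prod_decode z)))"
    "\<And>z. P (fst (prod_decode z)) (snd (prod_decode z)) \<longleftrightarrow> (\<exists>t. Q z t)"
    using semidecidableD[OF assms] by blast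
  have "(\<exists>n. P x n) \<longleftrightarrow>
      (\<exists>t. Q (prod_encode (x, fst (prod_decode t))) (snd (prod_decode t)))" for x
    using Q(2)[of "prod_encode (x, _)"] by (metis fst_conv snd_conv prod_encode_inverse)
  then show ?thesis
    by (intro semidecidableI[where
          Q = "\<lambda>x t. Q (prod_encode (x, fst (prod_decode t))) (snd (prod_decode t))"])
      (intro recursive_pred_comp2[OF Q(1)] recursive_intros)
qed

lemma semidecidable_conj:
  assumes "semidecidable P" "semidecidable P'"
  shows "semidecidable (\<lambda>x. P x \<and> P' x)"
proof -
  obtain Q Q' where Q: "recursive_pred (\<lambda>z. Q (fst (prod_decode z)) (snd (prod_decode z)))"
    "\<And>x. P x \<longleftrightarrow> (\<exists>t. Q x t)"
    and Q': "recursive_pred (\<lambda>z. Q' (fst (prod_decode z)) (snd (prod_decode z)))"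
    "\<And>x. P' x \<longleftrightarrow> (\<exists>t. Q' x t)"
    using assms[THEN semidecidableD] by blast
  have "P x \<and> P' x \<longleftrightarrow> (\<exists>t. Q x (fst (prod_decode t)) \<and> Q' x (snd (prod_decode t)))" for x
    unfolding Q(2) Q'(2) by (metis fst_conv snd_conv prod_encode_inverse)
  then show ?thesis
    by (intro semidecidableI[where
          Q = "\<lambda>x t. Q x (fst (prod_decode t)) \<and> Q' x (snd (prod_decode t))"])
      (intro recursive_pred_comp2[OF Q(1)] recursive_pred_comp2[OF Q'(1)] recursive_intros)
qed

lemma semidecidable_disj:
  assumes "semidecidable P" "semidecidable P'"
  shows "semidecidable (\<lambda>x. P x \<or> P' x)"
proof -
  obtain Q Q' where Q: "recursive_pred (\<lambda>z. Q (fst (prod_decode z)) (snd (prod_decode z)))"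
    "\<And>x. P x \<longleftrightarrow> (\<exists>t. Q x t)"
    and Q': "recursive_pred (\<lambda>z. Q' (fst (prod_decode z)) (snd (prod_decode z)))"
    "\<And>x. P' x \<longleftrightarrow> (\<exists>t. Q' x t)"
    using assms[THEN semidecidableD] by blast
  show ?thesis
    by (rule semidecidableI[where Q = "\<lambda>x t. Q x t \<or> Q' x t"])
      (intro recursive_pred_comp2[OF Q(1)] recursive_pred_comp2[OF Q'(1)] recursive_intros,
        auto simp: Q Q')
qed

text \<open>The premise is decidable so that its negation is semidecidable as well.\<close>

lemma semidecidable_imp:
  assumes "recursive_pred P" "semidecidable P'"
  shows "semidecidable (\<lambda>x. P x \<longrightarrow> P' x)"
  unfolding imp_conv_disj
  using semidecidable_disj[OF semidecidable_recursive[OF recursive_pred_not[OF assms(1)]] assms(2)] .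

text \<open>A common bound on the witnesses replaces the coding of a sequence of witnesses.\<close>

lemma semidecidable_ball:
  assumes "semidecidable (\<lambda>z. P (fst (prod_decode z)) (snd (prod_decode z)))"
    and b: "recursive_fun b"
  shows "semidecidable (\<lambda>x. \<forall>n<b x. P x n)"
proof -
  obtain Q where Q: "recursive_pred (\<lambda>z. Q (fst (prod_decode z)) (snd (prod_decode z)))"
    "\<And>z. P (fst (prod_decode z)) (snd (prod_decode z)) \<longleftrightarrow> (\<exists>t. Q z t)"
    using semidecidableD[OF assms(1)] by blast
  have P: "P x n \<longleftrightarrow> (\<exists>t. Q (prod_encode (x, n)) t)" for x n
    using Q(2)[of "prod_encode (x, n)"] by simp
  have "(\<forall>n<k. P x n) \<longleftrightarrow> (\<exists>T. \<forall>n<k. \<exists>t<T. Q (prod_encode (x, n)) t)" for x k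
  proof (induction k)
    case (Suc k)
    show ?case
    proof
      assume "\<forall>n<Suc k. P x n"
      then obtain T t where T: "\<forall>n<k. \<exists>t<T. Q (prod_encode (x, n)) t"
        and t: "Q (prod_encode (x, k)) t"
        using Suc P by auto
      \<comment> \<open>The old bound is raised just enough to admit the new witness
        \<open>t\<close>.\<close>
      have "\<forall>n<Suc k. \<exists>u<max T (Suc t). Q (prod_encode (x, n)) u"
        using T t by (auto simp: less_Suc_eq less_max_iff_disj)
      then show "\<exists>T. \<forall>n<Suc k. \<exists>t<T. Q (prod_encode (x, n)) t" by blast
    qed (use P in blast)
  qed simp
  then show ?thesis
    by (intro semidecidableI[where Q = "\<lambda>x T. \<forall>n<b x. \<exists>t<T. Q (prod_encode (x, n)) t"])
      (intro recursive_pred_comp2[OF Q(1)] recursive_intros recursive_fun_compose[OF b])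
qed

lemmas semidecidable_intros =
  semidecidable_ex semidecidable_conj semidecidable_disj semidecidable_imp semidecidable_ball

section \<open>Closure properties of \<open>\<Pi>\<^sub>2\<close> predicates\<close>

lemma pi2_pred_semidecidable: "semidecidable P \<Longrightarrow> pi2_pred P"
  by (rule pi2_predI[where Q = "\<lambda>x t. P x"])
    (rule semidecidable_comp, assumption, intro recursive_intros, simp)

lemma pi2_pred_all:
  assumes "pi2_pred (\<lambda>z. P (fst (prod_decode z)) (snd (prod_decode z)))"
  shows "pi2_pred (\<lambda>x. \<forall>n. P x n)"
proof -
  obtain Q where Q: "semidecidable Q"
    "\<And>z. P (fst (prod_decode z)) (snd (prod_decode z)) \<longleftrightarrow> (\<forall>t. Q (prod_encode (z, t)))"
    using assms unfolding pi2_pred_def by blast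
  have "(\<forall>n. P x n) \<longleftrightarrow>
      (\<forall>t. Q (prod_encode (prod_encode (x, fst (prod_decode t)), snd (prod_decode t))))" for x
    using Q(2)[of "prod_encode (x, _)"] by (metis fst_conv snd_conv prod_encode_inverse)
  then show ?thesis
    by (intro pi2_predI[where Q = "\<lambda>x t. Q (prod_encode (prod_encode (x, fst (prod_decode t)),
        snd (prod_decode t)))"])
      (intro semidecidable_comp[OF Q(1)] recursive_intros)
qed

lemma pi2_pred_conj:
  assumes "pi2_pred P" "pi2_pred P'"
  shows "pi2_pred (\<lambda>x. P x \<and> P' x)"
proof -
  obtain Q Q' where Q: "semidecidable Q" "\<And>x. P x \<longleftrightarrow> (\<forall>t. Q (prod_encode (x, t)))"
    and Q': "semidecidable Q'" "\<And>x. P' x \<longleftrightarrow> (\<forall>t. Q' (prod_encode (x, t)))"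
    using assms unfolding pi2_pred_def by blast
  show ?thesis
    by (rule pi2_predI[where Q = "\<lambda>x t. Q (prod_encode (x, t)) \<and> Q' (prod_encode (x, t))"])
      (intro semidecidable_conj semidecidable_comp[OF Q(1)] semidecidable_comp[OF Q'(1)]
        recursive_intros, auto simp: Q Q')
qed

text \<open>The existential quantifier of the premise leaves the implication as a universal one and
  is paired with that of the conclusion.\<close>

lemma pi2_pred_imp:
  assumes "semidecidable P" "pi2_pred P'"
  shows "pi2_pred (\<lambda>x. P x \<longrightarrow> P' x)"
proof -
  obtain Q where Q: "recursive_pred (\<lambda>z. Q (fst (prod_decode z)) (snd (prod_decode z)))"
    "\<And>x. P x \<longleftrightarrow> (\<exists>t. Q x t)"
    using semidecidableD[OF assms(1)] by blast
  obtain Q' where Q': "semidecidable Q'" "\<And>x. P' x \<longleftrightarrow> (\<forall>t. Q' (prod_encode (x, t)))"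
    using assms unfolding pi2_pred_def by blast
  have "(P x \<longrightarrow> P' x) \<longleftrightarrow>
      (\<forall>t. Q x (fst (prod_decode t)) \<longrightarrow> Q' (prod_encode (x, snd (prod_decode t))))" for x
    unfolding Q(2) Q'(2) by (metis fst_conv snd_conv prod_encode_inverse)
  then show ?thesis
    by (intro pi2_predI[where
          Q = "\<lambda>x t. Q x (fst (prod_decode t)) \<longrightarrow> Q' (prod_encode (x, snd (prod_decode t)))"])
      (intro semidecidable_imp recursive_pred_comp2[OF Q(1)] semidecidable_comp[OF Q'(1)]
        recursive_intros)
qed

section \<open>From predicates to r.e. sets and to matrices of formulas\<close>

lemma re_set_semidecidable:
  assumes "semidecidable (\<lambda>x. x \<in> A)"
  shows "re_set A"
proof (cases "A = {}")
  case False
  then obtain a where a: "a \<in> A" by blast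
  obtain Q where Q: "recursive_pred (\<lambda>z. Q (fst (prod_decode z)) (snd (prod_decode z)))"
    "\<And>x. x \<in> A \<longleftrightarrow> (\<exists>t. Q x t)"
    using semidecidableD[OF assms] by blast
  \<comment> \<open>The input is a candidate paired with a possible witness. If the witness fails,
    the fixed element \<open>a\<close> is output, which is why the empty set is treated
    apart.\<close>
  let ?f = "\<lambda>z. if Q (fst (prod_decode z)) (snd (prod_decode z)) then fst (prod_decode z) else a"
  have "recursive_fun ?f" by (intro recursive_fun_if recursive_pred_comp2[OF Q(1)] recursive_intros)
  moreover have "A = range ?f"
  proof
    show "range ?f \<subseteq> A" using a Q(2) by auto
    show "A \<subseteq> range ?f"
    proof
      fix x assume "x \<in> A"
      then obtain t where "Q x t" using Q(2) by blast
      then have "x = ?f (prod_encode (x, t))" by simp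
      then show "x \<in> range ?f" by blast
    qed
  qed
  ultimately show ?thesis unfolding re_set_def by blast
qed (simp add: re_set_def)

text \<open>Formulas append bound variables on the right, so pairs nested to the left code their
  argument lists. Unary predicates thereby become matrices of formulas.\<close>

lemma recursive_rel_foldl:
  assumes "recursive_pred P"
  shows "recursive_rel (Suc k) (\<lambda>xs. P (foldl (\<lambda>u v. prod_encode (u, v)) (hd xs) (tl xs)))"
proof -
  obtain q where q: "\<And>x y. eval_prog q [x, y] = Some (prod_encode (x, y))"
    using recursive_fun2_prod_encode unfolding recursive_fun2_def by auto
  obtain p where p: "\<And>x. eval_prog p [x] = Some (if P x then 1 else 0)"
    using assms unfolding recursive_pred_def recursive_fun_def by blast
  \<comment> \<open>Lists longer than needed are allowed and truncated, so that the program for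
    \<open>k\<close> can be reused on longer lists in the induction.\<close>
  have "\<exists>c. \<forall>xs. k < length xs \<longrightarrow> eval_prog c xs =
      Some (foldl (\<lambda>u v. prod_encode (u, v)) (hd xs) (take k (tl xs)))"
  proof (induction k)
    case 0
    show ?case by (rule exI[of _ "Proj 0"]) (auto simp: hd_conv_nth)
  next
    case (Suc k)
    then obtain c where c: "\<And>xs. k < length xs \<Longrightarrow> eval_prog c xs =
        Some (foldl (\<lambda>u v. prod_encode (u, v)) (hd xs) (take k (tl xs)))"
      by blast
    show ?case
      by (rule exI[of _ "Comp q [c, Proj (Suc k)]"])
        (auto simp: c q take_Suc_conv_app_nth nth_tl)
  qed
  then obtain c where c: "\<And>xs. k < length xs \<Longrightarrow> eval_prog c xs =
      Some (foldl (\<lambda>u v. prod_encode (u, v)) (hd xs) (take k (tl xs)))"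
    by blast
  show ?thesis
    unfolding recursive_rel_def by (rule exI[of _ "Comp p [c]"]) (auto simp: c p)
qed

section \<open>Finite positive teaching sets\<close>

definition teachable :: "nat set \<Rightarrow> nat set set \<Rightarrow> bool" where
  "teachable L F \<longleftrightarrow> (\<exists>S. finite S \<and> positive_teaching_set S L F)"

text \<open>All sizes in the infimum are finite, so it is below \<open>\<infinity>\<close> iff there
  is any size at all.\<close>

lemma TD_plus_finite_iff: "TD_plus L F < \<infinity> \<longleftrightarrow> teachable L F"
  unfolding TD_plus_def teachable_def Inf_less_iff by auto

lemma teachable_iff:
  "teachable L F \<longleftrightarrow> (\<exists>S. finite S \<and> S \<subseteq> L \<and> (\<forall>L'\<in>F. S \<subseteq> L' \<longrightarrow> L' = L))"
  unfolding teachable_def positive_teaching_set_def Bex_def Ball_def by simp metis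

text \<open>A finite part of \<open>L\<close> lies in a single stage because the stages increase,
  and enlarging a teaching set inside \<open>L\<close> keeps it one. So a search over finite sets
  becomes one over numbers.\<close>

lemma teachable_iff_stage:
  fixes A :: "nat \<Rightarrow> nat set"
  assumes "mono A" "\<And>s. finite (A s)" "L = (\<Union>s. A s)"
  shows "teachable L F \<longleftrightarrow> (\<exists>s. \<forall>L'\<in>F. A s \<subseteq> L' \<longrightarrow> L' = L)"
proof
  assume "teachable L F"
  then obtain S where S: "finite S" "S \<subseteq> L" "\<forall>L'\<in>F. S \<subseteq> L' \<longrightarrow> L' = L"
    unfolding teachable_iff by blast
  have "\<exists>s. S \<subseteq> A s"
    using S(1,2)
  proof (induction S rule: finite_induct)
    case (insert x S)
    then obtain s t where "S \<subseteq> A s" "x \<in> A t" using assms(3) by auto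
    moreover have "A s \<subseteq> A (max s t)" "A t \<subseteq> A (max s t)"
      using assms(1) by (simp_all add: monoD)
    ultimately show ?case by blast
  qed simp
  then obtain s where "S \<subseteq> A s" by blast
  then have "\<forall>L'\<in>F. A s \<subseteq> L' \<longrightarrow> L' = L" using S(3) by (meson subset_trans)
  then show "\<exists>s. \<forall>L'\<in>F. A s \<subseteq> L' \<longrightarrow> L' = L" by (rule exI)
next
  assume "\<exists>s. \<forall>L'\<in>F. A s \<subseteq> L' \<longrightarrow> L' = L"
  then obtain s where "\<forall>L'\<in>F. A s \<subseteq> L' \<longrightarrow> L' = L" by (rule exE)
  moreover have "A s \<subseteq> L" using assms(3) by blast
  ultimately show "teachable L F" unfolding teachable_iff using assms(2)[of s] by (intro exI conjI)
qed

text \<open>Sets with different tags are disjoint, so a teaching set with at least one point only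
  has to separate sets with the same tag.\<close>

lemma teachable_tagged_iff:
  assumes nonempty: "\<And>a. {} \<notin> F a"
  shows "(\<forall>L\<in>(\<Union>a. (\<lambda>X. (\<lambda>m. prod_encode (a, m)) ` X) ` F a).
            teachable L (\<Union>a. (\<lambda>X. (\<lambda>m. prod_encode (a, m)) ` X) ` F a))
         \<longleftrightarrow> (\<forall>a. \<forall>X\<in>F a. teachable X (F a))"
proof -
  define tag where "tag a X = (\<lambda>m. prod_encode (a, m)) ` X" for a X
  let ?G = "\<Union>a. tag a ` F a"
  have mem: "prod_encode (a, m) \<in> tag b X \<longleftrightarrow> a = b \<and> m \<in> X" for a b m X
    unfolding tag_def by auto
  have "teachable (tag a X) ?G \<longleftrightarrow> teachable X (F a)" if X: "X \<in> F a" for a X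
  proof
    assume "teachable (tag a X) ?G"
    then obtain S where S: "finite S" "S \<subseteq> tag a X" "\<forall>L'\<in>?G. S \<subseteq> L' \<longrightarrow> L' = tag a X"
      unfolding teachable_iff by blast
    let ?S = "(\<lambda>m. prod_encode (a, m)) -` S"
    have "finite ?S" by (rule finite_vimageI[OF S(1)]) (simp add: inj_on_def)
    moreover have "?S \<subseteq> X" using S(2) by (auto simp: mem)
    moreover have "X' = X" if "X' \<in> F a" "?S \<subseteq> X'" for X'
    proof -
      have "S \<subseteq> tag a X'" using S(2) that(2) by (fastforce simp: tag_def)
      moreover have "tag a X' \<in> ?G" using that(1) by blast
      ultimately have "tag a X' = tag a X" by (intro S(3)[rule_format])
      then have "m \<in> X' \<longleftrightarrow> m \<in> X" for m using mem[of a m a X'] mem[of a m a X] by simp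
      then show ?thesis by blast
    qed
    ultimately show "teachable X (F a)"
      unfolding teachable_iff by (intro exI[of _ ?S] conjI ballI impI)
  next
    assume "teachable X (F a)"
    then obtain S where S: "finite S" "S \<subseteq> X" "\<forall>L'\<in>F a. S \<subseteq> L' \<longrightarrow> L' = X"
      unfolding teachable_iff by blast
    \<comment> \<open>\<open>S\<close> may be empty and would then exclude no foreign tag, so a
      point of \<open>X\<close> is added.\<close>
    obtain x where x: "x \<in> X" using X nonempty[of a] by (cases "X = {}") auto
    have "L' = tag a X" if G: "L' \<in> ?G" and "tag a (insert x S) \<subseteq> L'" for L'
    proof -
      obtain b X' where L': "L' = tag b X'" "X' \<in> F b" using G by blast
      have *: "prod_encode (a, m) \<in> tag b X'" if "m \<in> insert x S" for m
        using that \<open>tag a (insert x S) \<subseteq> L'\<close> L'(1) mem[of a m a "insert x S"] by blast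
      then have "a = b" "S \<subseteq> X'" unfolding mem by auto
      then show ?thesis using S(3) L' by blast
    qed
    moreover have "finite (tag a (insert x S))" "tag a (insert x S) \<subseteq> tag a X"
      using S x by (auto simp: tag_def)
    ultimately show "teachable (tag a X) ?G"
      unfolding teachable_iff by (intro exI[of _ "tag a (insert x S)"] conjI ballI impI)
  qed
  then have "(\<forall>L\<in>?G. teachable L ?G) \<longleftrightarrow> (\<forall>a. \<forall>X\<in>F a. teachable X (F a))" by simp
  then show ?thesis unfolding tag_def[abs_def] .
qed

section \<open>A family whose teachability expresses
  \<open>\<exists>b. \<forall>c. U b c\<close>\<close>

text \<open>
  Row \<open>0\<close> codes the set of all \<open>(b, c)\<close> with \<open>U b c\<close>, where \<open>{c. U b c}\<close> is a nonempty initial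
  segment of \<open>\<nat>\<close>. If this segment is all of \<open>\<nat>\<close>, then row \<open>b + 1\<close> equals row \<open>0\<close>. Otherwise row
  \<open>b + 1\<close> is finite, and the marker \<open>(b, c)\<close> for the least \<open>c\<close> outside the segment lies in no
  other row. The truncated subtraction \<open>0 - 1\<close> does no harm, since \<open>U b 0\<close> holds.
\<close>

definition row :: "(nat \<Rightarrow> nat \<Rightarrow> bool) \<Rightarrow> nat \<Rightarrow> nat set" where
  "row U i = {m. (U (fst (prod_decode m)) (snd (prod_decode m)) \<and>
                  (i = 0 \<or> m \<le> i - 1 \<or> U (i - 1) m)) \<or>
                 (i \<noteq> 0 \<and> fst (prod_decode m) = i - 1 \<and> U (i - 1) (snd (prod_decode m) - 1))}"

text \<open>A finite part of row 0 lies in every later row \<open>Suc b\<close>, so teaching row 0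
  forces such a row to equal it. Conversely, by \<open>up\<close>, a witness leaves only finitely
  many rows different from row 0, each excluded by one point.\<close>

lemma teachable_rows_iff:
  assumes zero: "\<And>b. U b 0"
    and down: "\<And>b c c'. U b c \<Longrightarrow> c' \<le> c \<Longrightarrow> U b c'"
    and up: "\<And>b b' c. U b c \<Longrightarrow> b \<le> b' \<Longrightarrow> U b' c"
  shows "(\<forall>X\<in>range (row U). teachable X (range (row U))) \<longleftrightarrow> (\<exists>b. \<forall>c. U b c)"
proof -
  have mem0: "prod_encode (b, c) \<in> row U 0 \<longleftrightarrow> U b c" for b c
    by (simp add: row_def)
  have mem0': "m \<in> row U 0 \<longleftrightarrow> U (fst (prod_decode m)) (snd (prod_decode m))" for m
    by (simp add: row_def)
  have memS: "m \<in> row U (Suc b) \<longleftrightarrow> (m \<in> row U 0 \<and> (m \<le> b \<or> U b m)) \<or>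
      (fst (prod_decode m) = b \<and> U b (snd (prod_decode m) - 1))" for m b
    by (simp add: row_def)
  have full: "row U (Suc b) = row U 0" if "\<forall>c. U b c" for b
    using that by (auto simp: memS mem0')
  have marker: "\<exists>x. x \<in> row U (Suc b) \<and> (\<forall>i. x \<in> row U i \<longrightarrow> i = Suc b)"
    if "\<not> (\<forall>c. U b c)" for b
  proof -
    define c where "c = (LEAST c. \<not> U b c)"
    have c: "\<not> U b c" unfolding c_def using LeastI_ex[of "\<lambda>c. \<not> U b c"] that by blast
    have "U b (c - 1)"
    proof (cases c)
      case (Suc d)
      then have "\<not> \<not> U b d" using not_less_Least[of d "\<lambda>c. \<not> U b c"] unfolding c_def by simp
      then show ?thesis using Suc by simp
    qed (simp add: zero)
    then have "prod_encode (b, c) \<in> row U (Suc b)" by (simp add: memS)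
    \<comment> \<open>The first disjunct of \<open>row\<close> would require \<open>U b c\<close>;
      the second one ties \<open>i\<close> to \<open>b\<close>.\<close>
    moreover have "i = Suc b" if "prod_encode (b, c) \<in> row U i" for i
      using that c by (cases i) (auto simp: memS mem0)
    ultimately show ?thesis by blast
  qed
  have fin: "finite (row U (Suc b))" if proper: "\<not> (\<forall>c. U b c)" for b
  proof -
    obtain c where c: "\<not> U b c" using proper by blast
    have bound: "d < c" if "U b d" for d using down[OF that, of c] c by (meson not_less)
    \<comment> \<open>The three parts cover the clauses \<open>m \<le> b\<close>,
      \<open>U b m\<close> and the marker clause, whose predecessor allows \<open>d\<close> to reach
      \<open>c\<close>.\<close>
    have "row U (Suc b) \<subseteq> {..b} \<union> {..c} \<union> (\<lambda>d. prod_encode (b, d)) ` {..c}"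
    proof
      fix m assume "m \<in> row U (Suc b)"
      moreover have "m \<in> (\<lambda>d. prod_encode (b, d)) ` {..c}"
        if "fst (prod_decode m) = b" "U b (snd (prod_decode m) - 1)"
      proof
        show "m = prod_encode (b, snd (prod_decode m))"
          using that(1) by (simp add: eq_prod_encode_iff)
        show "snd (prod_decode m) \<in> {..c}" using bound[OF that(2)] by simp
      qed
      ultimately show "m \<in> {..b} \<union> {..c} \<union> (\<lambda>d. prod_encode (b, d)) ` {..c}"
        unfolding memS using bound[of m] by (elim disjE conjE) simp_all
    qed
    then show ?thesis by (rule finite_subset) simp
  qed
  \<comment> \<open>By \<open>zero\<close>, row 0 contains the code of \<open>(b, 0)\<close> for
    every \<open>b\<close>.\<close>
  have inf: "infinite (row U 0)"
  proof
    assume "finite (row U 0)"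
    then have "finite ((\<lambda>b. prod_encode (b, 0 :: nat)) -` row U 0)"
      by (rule finite_vimageI) (simp add: inj_on_def)
    moreover have "(\<lambda>b. prod_encode (b, 0 :: nat)) -` row U 0 = UNIV"
      by (auto simp: mem0 zero)
    ultimately show False by simp
  qed
  show ?thesis
  proof
    assume "\<forall>X\<in>range (row U). teachable X (range (row U))"
    then have "teachable (row U 0) (range (row U))" by simp
    then obtain S where S: "finite S" "S \<subseteq> row U 0"
      and S': "\<forall>X\<in>range (row U). S \<subseteq> X \<longrightarrow> X = row U 0"
      unfolding teachable_iff by blast
    \<comment> \<open>A bound on \<open>S\<close> picks a row that contains \<open>S\<close> through
      the clause \<open>m \<le> b\<close>.\<close>
    obtain b where b: "\<And>m. m \<in> S \<Longrightarrow> m \<le> b"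
      using S(1) finite_nat_set_iff_bounded_le by auto
    then have "S \<subseteq> row U (Suc b)" using S(2) by (auto simp: memS)
    then have eq: "row U (Suc b) = row U 0" using S' by simp
    have "\<forall>c. U b c"
    proof (rule ccontr)
      assume "\<not> (\<forall>c. U b c)"
      from marker[OF this] obtain x
        where "x \<in> row U (Suc b)" "\<forall>i. x \<in> row U i \<longrightarrow> i = Suc b"
        by blast
      then have "0 = Suc b" unfolding eq by blast
      then show False by simp
    qed
    then show "\<exists>b. \<forall>c. U b c" by blast
  next
    assume "\<exists>b. \<forall>c. U b c"
    then obtain b0 where b0: "\<And>b. b0 \<le> b \<Longrightarrow> \<forall>c. U b c" using up by blast
    \<comment> \<open>A finite row misses a point of the infinite row 0; finitely many such points
      will teach row 0.\<close>
    have "\<exists>y. y \<in> row U 0 \<and> y \<notin> row U (Suc b)" if "\<not> (\<forall>c. U b c)" for b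
      using finite_subset[OF _ fin[OF that], of "row U 0"] inf by blast
    then obtain y where y: "\<And>b. \<not> (\<forall>c. U b c) \<Longrightarrow> y b \<in> row U 0 \<and> y b \<notin> row U (Suc b)"
      by metis
    let ?S = "y ` {b. b < b0 \<and> \<not> (\<forall>c. U b c)}"
    have "row U i = row U 0" if "?S \<subseteq> row U i" for i
    proof (cases i)
      case (Suc b)
      show ?thesis
      proof (cases "\<forall>c. U b c")
        case False
        then have "b < b0" using b0 by (meson not_less)
        then show ?thesis using False y[OF False] that Suc by blast
      qed (use full Suc in simp)
    qed simp
    moreover have "finite ?S" by simp
    moreover have "?S \<subseteq> row U 0" using y by blast
    ultimately have limit: "teachable (row U 0) (range (row U))"
      unfolding teachable_iff by (intro exI[of _ ?S]) blast
    show "\<forall>X\<in>range (row U). teachable X (range (row U))"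
    proof
      fix X assume "X \<in> range (row U)"
      then obtain i where i: "X = row U i" by blast
      show "teachable X (range (row U))"
      proof (cases "i = 0 \<or> (\<forall>c. U (i - 1) c)")
        case True
        then have "X = row U 0" using i full[of "i - 1"] by (cases i) auto
        then show ?thesis using limit by simp
      next
        case False
        then obtain x where x: "x \<in> row U i" "\<forall>k. x \<in> row U k \<longrightarrow> k = i"
          using marker[of "i - 1"] by auto
        have "L' = row U i" if "L' \<in> range (row U)" "{x} \<subseteq> L'" for L'
        proof -
          from that(1) obtain k where k: "L' = row U k" by (rule rangeE)
          then have "k = i" using that(2) x(2) by simp
          then show ?thesis using k by simp
        qed
        then show ?thesis
          unfolding teachable_iff i using x(1) by (intro exI[of _ "{x}"] conjI ballI impI) simp_all
      qed
    qed
  qed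
qed

section \<open>The complexity of the index set\<close>

lemma uniformly_re_enumeration:
  assumes "uniformly_re W" "\<exists>i. W i \<noteq> {}"
  shows "\<exists>f. recursive_fun f \<and> (\<forall>i x. x \<in> W i \<longleftrightarrow> (\<exists>t. f t = prod_encode (i, x)))"
proof -
  let ?A = "{prod_encode (i, x) |i x. x \<in> W i}"
  have "?A \<noteq> {}" using assms(2) by blast
  then obtain f where f: "recursive_fun f" "?A = range f"
    using assms(1) unfolding uniformly_re_def re_set_def by blast
  have "x \<in> W i \<longleftrightarrow> prod_encode (i, x) \<in> ?A" for i x by auto
  then have "x \<in> W i \<longleftrightarrow> (\<exists>t. f t = prod_encode (i, x))" for i x
    unfolding f(2) by (metis rangeE rangeI)
  with f(1) show ?thesis by blast
qed

text \<open>The two outer quantifiers and the two hidden in the \<open>\<Pi>\<^sub>2\<close> matrix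
  form the prefix; the decidable kernel on nested codes becomes a relation of five
  arguments.\<close>

lemma pi_set_4I:
  assumes "pi2_pred (\<lambda>z. P (fst (prod_decode (fst (prod_decode z))))
      (snd (prod_decode (fst (prod_decode z)))) (snd (prod_decode z)))"
  shows "pi_set 4 {e. \<forall>j. \<exists>s. P e j s}"
proof -
  obtain Q where Q: "semidecidable Q" "\<And>e j s. P e j s \<longleftrightarrow>
      (\<forall>t. Q (prod_encode (prod_encode (prod_encode (e, j), s), t)))"
    using assms unfolding pi2_pred_def by (metis fst_conv snd_conv prod_encode_inverse)
  obtain D where D: "recursive_pred D" "\<And>x. Q x \<longleftrightarrow> (\<exists>t. D (prod_encode (x, t)))"
    using Q(1) unfolding semidecidable_def by blast
  have eq: "(\<forall>j. \<exists>s. P e j s) \<longleftrightarrow> (\<forall>j. \<exists>s. \<forall>t. \<exists>u.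
      D (prod_encode (prod_encode (prod_encode (prod_encode (e, j), s), t), u)))" for e
    by (simp only: Q(2) D(2))
  show ?thesis
    unfolding pi_set_def
    by (intro exI conjI, rule recursive_rel_foldl[OF D(1)]) (simp add: numeral_eq_Suc eq)
qed

lemma pi_set_I_forall_TD_plus:
  assumes "uniformly_re W" "\<exists>i. W i \<noteq> {}"
  shows "pi_set 4 (I_forall_TD_plus W)"
proof -
  obtain f where f: "recursive_fun f" "\<And>i x. x \<in> W i \<longleftrightarrow> (\<exists>t. f t = prod_encode (i, x))"
    using uniformly_re_enumeration[OF assms] by blast
  define stage where "stage e j s = {x. \<exists>t<s. f t = prod_encode (e, prod_encode (j, x))}" for e j s
  \<comment> \<open>The premise says that language \<open>k\<close> contains stage \<open>s\<close>
    of language \<open>j\<close>. Decoding \<open>f t\<close> instead of quantifying over elements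
    leaves a bounded quantifier, so the premise is semidecidable. The conclusion is equality of the
    two languages.\<close>
  let ?P = "\<lambda>e j s. \<forall>k.
      (\<forall>t<s. fst (prod_decode (f t)) = e \<and> fst (prod_decode (snd (prod_decode (f t)))) = j \<longrightarrow>
        (\<exists>u. f u = prod_encode (e, prod_encode (k, snd (prod_decode (snd (prod_decode (f t))))))))
      \<longrightarrow> (\<forall>x. ((\<exists>u. f u = prod_encode (e, prod_encode (k, x))) \<longrightarrow>
                 (\<exists>u. f u = prod_encode (e, prod_encode (j, x)))) \<and>
               ((\<exists>u. f u = prod_encode (e, prod_encode (j, x))) \<longrightarrow>
                 (\<exists>u. f u = prod_encode (e, prod_encode (k, x)))))"
  have language: "x \<in> language W e j \<longleftrightarrow> (\<exists>t. f t = prod_encode (e, prod_encode (j, x)))" for e j x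
    unfolding language_def f(2) by simp
  have "teachable (language W e j) (language_family W e) \<longleftrightarrow> (\<exists>s. ?P e j s)" for e j
  proof -
    have "finite (stage e j s)" for s
    proof (rule finite_subset)
      show "stage e j s \<subseteq> (\<lambda>t. snd (prod_decode (snd (prod_decode (f t))))) ` {..<s}"
        unfolding stage_def by force
    qed simp
    moreover have "mono (stage e j)"
      unfolding stage_def mono_def by (auto intro: less_le_trans)
    moreover have "language W e j = (\<Union>s. stage e j s)"
      unfolding stage_def using lessI by (fastforce simp: language)
    ultimately have "teachable (language W e j) (language_family W e) \<longleftrightarrow>
        (\<exists>s. \<forall>L'\<in>language_family W e. stage e j s \<subseteq> L' \<longrightarrow> L' = language W e j)"
      by (intro teachable_iff_stage)
    moreover have "(\<forall>L'\<in>language_family W e. stage e j s \<subseteq> L' \<longrightarrow> L' = language W e j) \<longleftrightarrow>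
        ?P e j s" for s
    proof -
      have subset: "stage e j s \<subseteq> language W e k \<longleftrightarrow> (\<forall>t<s. fst (prod_decode (f t)) = e \<and>
          fst (prod_decode (snd (prod_decode (f t)))) = j \<longrightarrow>
          snd (prod_decode (snd (prod_decode (f t)))) \<in> language W e k)" for k
      proof -
        have "f t = prod_encode (e, prod_encode (j, x)) \<longleftrightarrow> fst (prod_decode (f t)) = e \<and>
            fst (prod_decode (snd (prod_decode (f t)))) = j \<and>
            snd (prod_decode (snd (prod_decode (f t)))) = x" for t x
          unfolding eq_prod_encode_iff by auto
        then show ?thesis unfolding stage_def by auto
      qed
      have eq: "language W e k = language W e j \<longleftrightarrow>
          (\<forall>x. (x \<in> language W e k \<longrightarrow> x \<in> language W e j) \<and>
            (x \<in> language W e j \<longrightarrow> x \<in> language W e k))" for k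
        by blast
      have "(\<forall>L'\<in>language_family W e. Q L') \<longleftrightarrow> (\<forall>k. Q (language W e k))" for Q
        unfolding language_family_def by blast
      then show ?thesis by (simp only: subset eq language[symmetric])
    qed
    ultimately show ?thesis by simp
  qed
  then have "I_forall_TD_plus W = {e. \<forall>j. \<exists>s. ?P e j s}"
    unfolding I_forall_TD_plus_def TD_plus_finite_iff by (auto simp: language_family_def)
  moreover have "pi_set 4 {e. \<forall>j. \<exists>s. ?P e j s}"
    by (intro pi_set_4I pi2_pred_all pi2_pred_imp pi2_pred_conj
        pi2_pred_semidecidable semidecidable_intros
        semidecidable_recursive[OF recursive_pred_eq]
        recursive_fun_compose[OF f(1)] recursive_intros)
  ultimately show ?thesis by simp
qed

section \<open>Many-one hardness for \<open>\<Pi>\<^sub>4\<close>\<close>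

lemma pi_set_4_many_one_reducible:
  assumes "acceptable_numbering W" "pi_set 4 B"
  shows "many_one_reducible B (I_forall_TD_plus W)"
proof -
  obtain R where R: "recursive_rel 5 R"
    and B: "\<And>x. x \<in> B \<longleftrightarrow> (\<forall>a. \<exists>b. \<forall>c. \<exists>d. R [x, a, b, c, d])"
    using assms(2) unfolding pi_set_def by (auto simp: numeral_eq_Suc)
  have R': "recursive_pred (\<lambda>z. R [f1 z, f2 z, f3 z, f4 z, f5 z])"
    if "recursive_fun f1" "recursive_fun f2" "recursive_fun f3" "recursive_fun f4"
      "recursive_fun f5" for f1 f2 f3 f4 f5
    using recursive_rel_imp_recursive_pred[of "[f1, f2, f3, f4, f5]" R] R that
    by (auto simp: numeral_eq_Suc)
  \<comment> \<open>Allowing any \<open>b' \<le> b\<close> makes \<open>U\<close> monotone in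
    \<open>b\<close>; testing only \<open>c' < c\<close> makes it downward closed in
    \<open>c\<close> and true at 0, as the rows require.\<close>
  define U where "U x a b c \<longleftrightarrow> (\<exists>b'. b' \<le> b \<and> (\<forall>c'<c. \<exists>d. R [x, a, b', c', d]))" for x a b c
  \<comment> \<open>Only finitely many \<open>b'\<close> compete for a given \<open>b\<close>. If
    each failed at some \<open>g b'\<close>, a \<open>c\<close> beyond all these failures would
    refute \<open>U x a b c\<close>.\<close>
  have U: "(\<exists>b. \<forall>c. U x a b c) \<longleftrightarrow> (\<exists>b. \<forall>c. \<exists>d. R [x, a, b, c, d])" for x a
  proof
    assume "\<exists>b. \<forall>c. U x a b c"
    then obtain b where b: "\<And>c. U x a b c" by blast
    show "\<exists>b. \<forall>c. \<exists>d. R [x, a, b, c, d]"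
    proof (rule ccontr)
      assume "\<not> (\<exists>b. \<forall>c. \<exists>d. R [x, a, b, c, d])"
      then obtain g where g: "\<And>b. \<not> (\<exists>d. R [x, a, b, g b, d])" by metis
      obtain b' where b': "b' \<le> b" "\<forall>c'<Suc (Max (g ` {..b})). \<exists>d. R [x, a, b', c', d]"
        using b unfolding U_def by blast
      have "g b' \<le> Max (g ` {..b})" using b'(1) by simp
      then show False using b'(2) g by (meson le_imp_less_Suc)
    qed
  qed (auto simp: U_def)
  \<comment> \<open>The elements code \<open>((a, i), (a, m))\<close> with \<open>m\<close> in row
    \<open>i\<close> of subfamily \<open>a\<close>, so the languages are exactly the tagged
    rows.\<close>
  define V where "V x = {z. snd (prod_decode z) \<in>
      (\<lambda>m. prod_encode (fst (prod_decode (fst (prod_decode z))), m)) `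
      row (U x (fst (prod_decode (fst (prod_decode z))))) (snd (prod_decode (fst (prod_decode z))))}" for x
  have V: "z \<in> V x \<longleftrightarrow>
      fst (prod_decode (snd (prod_decode z))) = fst (prod_decode (fst (prod_decode z))) \<and>
      snd (prod_decode (snd (prod_decode z))) \<in>
        row (U x (fst (prod_decode (fst (prod_decode z))))) (snd (prod_decode (fst (prod_decode z))))"
    for x z
  proof -
    have "y \<in> (\<lambda>m. prod_encode (a, m)) ` X \<longleftrightarrow>
        fst (prod_decode y) = a \<and> snd (prod_decode y) \<in> X" for y a X
      by (auto simp: image_iff eq_prod_encode_iff)
    then show ?thesis unfolding V_def by simp
  qed
  have semi_U: "semidecidable (\<lambda>z. U (f1 z) (f2 z) (f3 z) (f4 z))"
    if "recursive_fun f1" "recursive_fun f2" "recursive_fun f3" "recursive_fun f4" for f1 f2 f3 f4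
    unfolding U_def
    by (intro semidecidable_ex semidecidable_conj semidecidable_ball
        semidecidable_recursive[OF R'] semidecidable_recursive[OF recursive_pred_le]
        recursive_fun_compose[OF that(1)] recursive_fun_compose[OF that(2)]
        recursive_fun_compose[OF that(3)] recursive_fun_compose[OF that(4)] recursive_intros)
  have "semidecidable (\<lambda>z. snd (prod_decode z) \<in> V (fst (prod_decode z)))"
    unfolding V row_def mem_Collect_eq
    by (intro semidecidable_conj semidecidable_disj semi_U
        semidecidable_recursive[OF recursive_pred_le] semidecidable_recursive[OF recursive_pred_eq]
        semidecidable_recursive[OF recursive_pred_not] recursive_intros)
  moreover have "{prod_encode (i, x) |i x. x \<in> V i} =
      {z. snd (prod_decode z) \<in> V (fst (prod_decode z))}"
    by (auto simp: eq_prod_encode_iff)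
  ultimately have "uniformly_re V"
    unfolding uniformly_re_def by (intro re_set_semidecidable) simp
  \<comment> \<open>Acceptability turns the uniformly r.e. sequence \<open>V\<close> into the
    reduction.\<close>
  then obtain g where g: "recursive_fun g" "\<And>x. V x = W (g x)"
    using assms(1) unfolding acceptable_numbering_def by blast
  have "x \<in> B \<longleftrightarrow> g x \<in> I_forall_TD_plus W" for x
  proof -
    have zero: "U x a b 0" for a b unfolding U_def by auto
    have rows: "(\<forall>X\<in>range (row (U x a)). teachable X (range (row (U x a)))) \<longleftrightarrow>
        (\<exists>b. \<forall>c. U x a b c)" for a
    proof (rule teachable_rows_iff)
      show "U x a b c'" if "U x a b c" "c' \<le> c" for b c c'
        using that unfolding U_def by (meson less_le_trans)
      show "U x a b' c" if "U x a b c" "b \<le> b'" for b b' c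
        using that unfolding U_def by (meson order_trans)
    qed (rule zero)
    \<comment> \<open>This code is 0, so it meets \<open>m \<le> i - 1\<close> in every row with
      positive index.\<close>
    have "prod_encode (0, 0) \<in> row (U x a) i" for a i
      by (simp add: row_def zero) (simp add: prod_encode_def)
    then have nonempty: "{} \<notin> range (row (U x a))" for a by blast
    have "language W (g x) j = (\<lambda>m. prod_encode (fst (prod_decode j), m)) `
        row (U x (fst (prod_decode j))) (snd (prod_decode j))" for j
      unfolding language_def g(2)[symmetric] V_def by simp
    then have "language_family W (g x) =
        (\<Union>a. (\<lambda>X. (\<lambda>m. prod_encode (a, m)) ` X) ` range (row (U x a)))"
      unfolding language_family_def
      by (auto simp: image_iff) (metis fst_conv snd_conv prod_encode_inverse)
    then have "g x \<in> I_forall_TD_plus W \<longleftrightarrow>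
        (\<forall>a. \<forall>X\<in>range (row (U x a)). teachable X (range (row (U x a))))"
      unfolding I_forall_TD_plus_def TD_plus_finite_iff
      using teachable_tagged_iff[of "\<lambda>a. range (row (U x a))", OF nonempty] by simp
    then show ?thesis unfolding rows U B by simp
  qed
  with g(1) show ?thesis unfolding many_one_reducible_def by blast
qed

theorem theorem8:
  fixes W :: "nat \<Rightarrow> nat set"
  assumes "acceptable_numbering W"
  shows "pi_complete 4 (I_forall_TD_plus W)"
proof -
  \<comment> \<open>Provides a nonempty \<open>W i\<close>, so that the graph of \<open>W\<close>
    has a recursive enumeration.\<close>
  have "re_set UNIV"
    unfolding re_set_def using recursive_fun_id by (intro disjI2 exI[of _ "\<lambda>x. x"]) simp
  then have "UNIV \<in> range W" using assms unfolding acceptable_numbering_def by simp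
  then have "\<exists>i. W i \<noteq> {}" by (metis UNIV_not_empty rangeE)
  then have "pi_set 4 (I_forall_TD_plus W)"
    using assms unfolding acceptable_numbering_def by (intro pi_set_I_forall_TD_plus) auto
  then show ?thesis
    unfolding pi_complete_def using pi_set_4_many_one_reducible[OF assms] by blast
qed

end
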